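(* Let $\mathfrak g$ be a Lie algebra over a field $k$ of characteristic other than $2$, let $N=k\oplus\mathfrak g$ with its coalgebra structure and map $q:N\otimes N\to N$ described in the context, and let $\psi:\mathfrak g\times\mathfrak g\to\mathfrak g$ be a Lie algebra $2$-cocycle with adjoint action. Define the linear map $\hat\psi:N\otimes N\to N$ by $\hat\psi((a+x)\otimes(b+y))=\psi(x,y)$ for $a,b\in k$, $x,y\in\mathfrak g$. Then $\hat\psi$ is a shelf $2$-cocycle: $d^{2,1}(\hat\psi,0)=d^{2,2}(\hat\psi,0)=0$.
   Context: A Lie algebra $2$-cocycle with adjoint action is a bilinear map $\psi:\mathfrak g\times\mathfrak g\to\mathfrak g$ with $\psi(y,x)=-\psi(x,y)$ and $$[\psi(x,y),z]+[\psi(y,z),x]+[\psi(z,x),y]+\psi([x,y],z)+\psi([y,z],x)+\psi([z,x],y)=0 .$$ $N=k\oplus\mathfrak g$ is the cocommutative coalgebra with $\Delta(1)=1\otimes 1$, $\Delta(x)=x\otimes 1+1\otimes x$, $\epsilon(1)=1$, $\epsilon(x)=0$ for $x\in\mathfrak g$, and $q((a+x)\otimes(b+y))=ab+bx+[x,y]$. For linear $\eta:N\otimes N\to N$, with $\tau$ the flip and $\tau_2=1\otimes\tau\otimes 1$: $$d^{2,1}(\eta,0)=q(\eta\otimes 1)+\eta(q\otimes 1)-\big[\eta(q\otimes q)+q(\eta\otimes q)+q(q\otimes\eta)\big]\tau_2(1\otimes 1\otimes\Delta):N^{\otimes 3}\to N,$$ $$d^{2,2}(\eta,0)=\Delta\eta-\big[(\eta\otimes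 q)+(q\otimes\eta)\big]\tau_2(\Delta\otimes\Delta):N^{\otimes 2}\to N^{\otimes 2}.$$ *)

theory Defs
  imports "Jordan_Normal_Form.Missing_VectorSpace" "HOL-Algebra.Multiplicative_Group"
begin

text \<open>
  Vector spaces, linear maps and direct sums are those of the AFP entry VectorSpace
  (\<^locale>\<open>vectorspace\<close>, \<^const>\<open>LinearCombinations.module_hom\<close>, \<^const>\<open>direct_sum\<close>). Maps are only meaningful on the
  carrier of their domain.
\<close>

text \<open>The additive order of \<open>1\<close>, which is \<open>0\<close> if that order is infinite.\<close>

definition characteristic :: "('k, 'm) ring_scheme \<Rightarrow> nat" where
  "characteristic K = group.ord (add_monoid K) \<one>\<^bsub>K\<^esub>"

definition self_module :: "('k, 'm) ring_scheme \<Rightarrow> ('k, 'k) module" where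
  "self_module K = \<lparr>carrier = carrier K, mult = mult K, one = \<one>\<^bsub>K\<^esub>, zero = \<zero>\<^bsub>K\<^esub>,
     add = add K, smult = mult K\<rparr>"

definition bilinear_map ::
  "('k, 'm) ring_scheme \<Rightarrow> ('k, 'u, 'a) module_scheme \<Rightarrow> ('k, 'v, 'b) module_scheme \<Rightarrow>
   ('k, 'w, 'c) module_scheme \<Rightarrow> ('u \<Rightarrow> 'v \<Rightarrow> 'w) \<Rightarrow> bool" where
  "bilinear_map K U V W f \<longleftrightarrow>
     (\<forall>u\<in>carrier U. (\<lambda>v. f u v) \<in> LinearCombinations.module_hom K V W) \<and>
     (\<forall>v\<in>carrier V. (\<lambda>u. f u v) \<in> LinearCombinations.module_hom K U W)"


section \<open>Tensor products\<close>

text \<open>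
  \<open>U \<otimes> V\<close> is the free vector space on \<open>U \<times> V\<close> modulo the bilinearity relations; its elements
  are cosets. The \<open>mult\<close> and \<open>one\<close> fields of the module records are irrelevant fillers.
\<close>

definition free_module :: "('k, 'm) ring_scheme \<Rightarrow> 'x set \<Rightarrow> ('k, 'x \<Rightarrow> 'k) module" where
  "free_module K X = \<lparr>
     carrier = {f. (\<forall>x\<in>X. f x \<in> carrier K) \<and> (\<forall>x. x \<notin> X \<longrightarrow> f x = \<zero>\<^bsub>K\<^esub>) \<and> finite {x. f x \<noteq> \<zero>\<^bsub>K\<^esub>}},
     mult = (\<lambda>f g x. \<zero>\<^bsub>K\<^esub>), one = (\<lambda>x. \<zero>\<^bsub>K\<^esub>), zero = (\<lambda>x. \<zero>\<^bsub>K\<^esub>),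
     add = (\<lambda>f g x. f x \<oplus>\<^bsub>K\<^esub> g x), smult = (\<lambda>a f x. a \<otimes>\<^bsub>K\<^esub> f x)\<rparr>"

definition free_gen :: "('k, 'm) ring_scheme \<Rightarrow> 'x \<Rightarrow> 'x \<Rightarrow> 'k" where
  "free_gen K x = (\<lambda>y. if y = x then \<one>\<^bsub>K\<^esub> else \<zero>\<^bsub>K\<^esub>)"

text \<open>The scalar multiple of a coset is taken on representatives (the pointwise multiple of a
  coset by \<open>0\<close> would be \<open>{0}\<close> rather than \<open>H\<close>).\<close>

definition quotient_module :: "('k, 'v, 'b) module_scheme \<Rightarrow> 'v set \<Rightarrow> ('k, 'v set) module" where
  "quotient_module M H = \<lparr>carrier = a_rcosets\<^bsub>M\<^esub> H, mult = (\<lambda>A B. H), one = H, zero = H,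
     add = (\<lambda>A B. A <+>\<^bsub>M\<^esub> B), smult = (\<lambda>a A. \<Union>x\<in>A. H +>\<^bsub>M\<^esub> (a \<odot>\<^bsub>M\<^esub> x))\<rparr>"

definition tensor_relators ::
  "('k, 'm) ring_scheme \<Rightarrow> ('k, 'u, 'a) module_scheme \<Rightarrow> ('k, 'v, 'b) module_scheme \<Rightarrow>
   ('u \<times> 'v \<Rightarrow> 'k) set" where
  "tensor_relators K U V = (let F = free_module K (carrier U \<times> carrier V); e = free_gen K in
     {e (u \<oplus>\<^bsub>U\<^esub> u', v) \<ominus>\<^bsub>F\<^esub> (e (u, v) \<oplus>\<^bsub>F\<^esub> e (u', v)) | u u' v.
        u \<in> carrier U \<and> u' \<in> carrier U \<and> v \<in> carrier V} \<union>
     {e (u, v \<oplus>\<^bsub>V\<^esub> v') \<ominus>\<^bsub>F\<^esub> (e (u, v) \<oplus>\<^bsub>F\<^esub> e (u, v')) | u v v'.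
        u \<in> carrier U \<and> v \<in> carrier V \<and> v' \<in> carrier V} \<union>
     {e (a \<odot>\<^bsub>U\<^esub> u, v) \<ominus>\<^bsub>F\<^esub> a \<odot>\<^bsub>F\<^esub> e (u, v) | a u v.
        a \<in> carrier K \<and> u \<in> carrier U \<and> v \<in> carrier V} \<union>
     {e (u, a \<odot>\<^bsub>V\<^esub> v) \<ominus>\<^bsub>F\<^esub> a \<odot>\<^bsub>F\<^esub> e (u, v) | a u v.
        a \<in> carrier K \<and> u \<in> carrier U \<and> v \<in> carrier V})"

definition tensor_null ::
  "('k, 'm) ring_scheme \<Rightarrow> ('k, 'u, 'a) module_scheme \<Rightarrow> ('k, 'v, 'b) module_scheme \<Rightarrow>
   ('u \<times> 'v \<Rightarrow> 'k) set" where
  "tensor_null K U V =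
     LinearCombinations.module.span K (free_module K (carrier U \<times> carrier V)) (tensor_relators K U V)"

definition tensor ::
  "('k, 'm) ring_scheme \<Rightarrow> ('k, 'u, 'a) module_scheme \<Rightarrow> ('k, 'v, 'b) module_scheme \<Rightarrow>
   ('k, ('u \<times> 'v \<Rightarrow> 'k) set) module" where
  "tensor K U V = quotient_module (free_module K (carrier U \<times> carrier V)) (tensor_null K U V)"

definition pure_tensor ::
  "('k, 'm) ring_scheme \<Rightarrow> ('k, 'u, 'a) module_scheme \<Rightarrow> ('k, 'v, 'b) module_scheme \<Rightarrow>
   'u \<Rightarrow> 'v \<Rightarrow> ('u \<times> 'v \<Rightarrow> 'k) set" where
  "pure_tensor K U V u v =
     tensor_null K U V +>\<^bsub>free_module K (carrier U \<times> carrier V)\<^esub> free_gen K (u, v)"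

definition free_eval ::
  "('k, 'm) ring_scheme \<Rightarrow> ('k, 'w, 'c) module_scheme \<Rightarrow> ('x \<Rightarrow> 'w) \<Rightarrow> ('x \<Rightarrow> 'k) \<Rightarrow> 'w" where
  "free_eval K W f c = (\<Oplus>\<^bsub>W\<^esub>x\<in>{x. c x \<noteq> \<zero>\<^bsub>K\<^esub>}. c x \<odot>\<^bsub>W\<^esub> f x)"

text \<open>The linear map \<open>U \<otimes> V \<rightarrow> W\<close> induced by a bilinear map \<open>f\<close>: the common value of the linear
  extension of \<open>f\<close> on the representatives of a coset.\<close>

definition tensor_lift ::
  "('k, 'm) ring_scheme \<Rightarrow> ('k, 'w, 'c) module_scheme \<Rightarrow> ('u \<Rightarrow> 'v \<Rightarrow> 'w) \<Rightarrow>
   ('u \<times> 'v \<Rightarrow> 'k) set \<Rightarrow> 'w" where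
  "tensor_lift K W f T = the_elem (free_eval K W (\<lambda>(u, v). f u v) ` T)"

text \<open>\<open>f \<otimes> g : U \<otimes> V \<rightarrow> U' \<otimes> V'\<close>, where \<open>U'\<close> and \<open>V'\<close> are the codomains of \<open>f\<close> and \<open>g\<close>.\<close>

definition tensor_map ::
  "('k, 'm) ring_scheme \<Rightarrow> ('k, 'u2, 'a) module_scheme \<Rightarrow> ('k, 'v2, 'b) module_scheme \<Rightarrow>
   ('u1 \<Rightarrow> 'u2) \<Rightarrow> ('v1 \<Rightarrow> 'v2) \<Rightarrow> ('u1 \<times> 'v1 \<Rightarrow> 'k) set \<Rightarrow> ('u2 \<times> 'v2 \<Rightarrow> 'k) set" where
  "tensor_map K U' V' f g = tensor_lift K (tensor K U' V') (\<lambda>u v. pure_tensor K U' V' (f u) (g v))"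

text \<open>\<open>\<tau>\<^sub>2 = 1 \<otimes> \<tau> \<otimes> 1\<close> on \<open>V\<^sup>\<otimes>\<^sup>4\<close>, bracketed as \<open>(V \<otimes> V) \<otimes> (V \<otimes> V)\<close>:
  \<open>(a \<otimes> b) \<otimes> (c \<otimes> d) \<mapsto> (a \<otimes> c) \<otimes> (b \<otimes> d)\<close>.\<close>

definition tensor_flip_mid ::
  "('k, 'm) ring_scheme \<Rightarrow> ('k, 'v, 'a) module_scheme \<Rightarrow>
   (('v \<times> 'v \<Rightarrow> 'k) set \<times> ('v \<times> 'v \<Rightarrow> 'k) set \<Rightarrow> 'k) set \<Rightarrow>
   (('v \<times> 'v \<Rightarrow> 'k) set \<times> ('v \<times> 'v \<Rightarrow> 'k) set \<Rightarrow> 'k) set" where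
  "tensor_flip_mid K V = (let V2 = tensor K V V; V4 = tensor K V2 V2 in
     tensor_lift K V4 (\<lambda>s t.
       tensor_lift K V4 (\<lambda>a b.
         tensor_lift K V4 (\<lambda>c d.
           pure_tensor K V2 V2 (pure_tensor K V V a c) (pure_tensor K V V b d)) t) s))"


subsection \<open>The universal property\<close>

text \<open>\<open>pure_tensor_bilinear\<close>, \<open>tensor_lift_pure\<close>, \<open>tensor_lift_hom\<close> and \<open>tensor_hom_ext\<close> show that
  \<open>tensor\<close> is a tensor product and that \<open>tensor_lift\<close> is the induced linear map.\<close>

lemma free_module_simps [simp]:
  "zero (free_module K X) = (\<lambda>x. \<zero>\<^bsub>K\<^esub>)"
  "add (free_module K X) f g = (\<lambda>x. f x \<oplus>\<^bsub>K\<^esub> g x)"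
  "smult (free_module K X) a f = (\<lambda>x. a \<otimes>\<^bsub>K\<^esub> f x)"
  by (simp_all add: free_module_def)

lemma free_module_carrier:
  "f \<in> carrier (free_module K X) \<longleftrightarrow>
    (\<forall>x\<in>X. f x \<in> carrier K) \<and> (\<forall>x. x \<notin> X \<longrightarrow> f x = \<zero>\<^bsub>K\<^esub>) \<and> finite {x. f x \<noteq> \<zero>\<^bsub>K\<^esub>}"
  by (simp add: free_module_def)

lemma free_module_is_module:
  assumes "cring K" shows "Module.module K (free_module K X)"
proof -
  interpret cring K by fact
  have cl: "f x \<in> carrier K" if "f \<in> carrier (free_module K X)" for f x
    using that by (cases "x \<in> X") (auto simp: free_module_carrier)
  have add: "(\<lambda>x. f x \<oplus>\<^bsub>K\<^esub> g x) \<in> carrier (free_module K X)"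
    if "f \<in> carrier (free_module K X)" "g \<in> carrier (free_module K X)" for f g
  proof -
    have "{x. f x \<oplus>\<^bsub>K\<^esub> g x \<noteq> \<zero>\<^bsub>K\<^esub>} \<subseteq> {x. f x \<noteq> \<zero>\<^bsub>K\<^esub>} \<union> {x. g x \<noteq> \<zero>\<^bsub>K\<^esub>}" by auto
    then show ?thesis using that by (auto simp: free_module_carrier intro: finite_subset)
  qed
  have sm: "(\<lambda>x. a \<otimes>\<^bsub>K\<^esub> f x) \<in> carrier (free_module K X)"
    if "a \<in> carrier K" "f \<in> carrier (free_module K X)" for a f
  proof -
    have "{x. a \<otimes>\<^bsub>K\<^esub> f x \<noteq> \<zero>\<^bsub>K\<^esub>} \<subseteq> {x. f x \<noteq> \<zero>\<^bsub>K\<^esub>}" using that by auto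
    then show ?thesis using that by (auto simp: free_module_carrier intro: finite_subset)
  qed
  have neg: "(\<lambda>x. \<ominus>\<^bsub>K\<^esub> f x) \<in> carrier (free_module K X)"
    if "f \<in> carrier (free_module K X)" for f
  proof -
    have "{x. \<ominus>\<^bsub>K\<^esub> f x \<noteq> \<zero>\<^bsub>K\<^esub>} \<subseteq> {x. f x \<noteq> \<zero>\<^bsub>K\<^esub>}" using that by auto
    then show ?thesis using that by (auto simp: free_module_carrier intro: finite_subset)
  qed
  show ?thesis
    apply (rule module_criteria)
    apply (fact)
    subgoal by (simp add: free_module_carrier)
    subgoal using add by simp
    subgoal
    proof
      fix v assume v: "v \<in> carrier (free_module K X)"
      show "\<exists>n\<in>carrier (free_module K X). v \<oplus>\<^bsub>free_module K X\<^esub> n = \<zero>\<^bsub>free_module K X\<^esub>"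
        using neg[OF v] cl[OF v] by (intro bexI[where x="\<lambda>x. \<ominus>\<^bsub>K\<^esub> v x"]) (auto simp: r_neg)
    qed
    subgoal using sm by simp
    subgoal using cl by (auto simp: a_ac)
    subgoal using cl by (auto simp: a_ac)
    subgoal using cl by auto
    subgoal using cl by (auto simp: m_assoc)
    subgoal using cl by auto
    subgoal using cl by (auto simp: l_distr)
    subgoal using cl by (auto simp: r_distr)
    done
qed

lemma free_gen_carrier: "cring K \<Longrightarrow> x \<in> X \<Longrightarrow> free_gen K x \<in> carrier (free_module K X)"
proof -
  assume "cring K" "x \<in> X"
  interpret cring K by fact
  have "{y. free_gen K x y \<noteq> \<zero>\<^bsub>K\<^esub>} \<subseteq> {x}" by (auto simp: free_gen_def)
  then have "finite {y. free_gen K x y \<noteq> \<zero>\<^bsub>K\<^esub>}" by (rule finite_subset) simp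
  then show ?thesis using \<open>x \<in> X\<close> by (simp add: free_module_carrier) (auto simp: free_gen_def)
qed

context
  fixes R :: "('a, 'm) ring_scheme" and M :: "('a, 'b, 'n) module_scheme" and H
  assumes M: "Module.module R M" and H: "submodule R H M"
begin

interpretation M: Module.module R M by (fact M)

private lemma abelian_subgroup_H: "abelian_subgroup H M"
proof (rule abelian_subgroupI3)
  show "additive_subgroup H M"
  proof (rule additive_subgroupI, rule M.add.subgroupI)
    show "H \<subseteq> carrier M" using H by (simp add: submodule_def)
    show "H \<noteq> {}" using H by (auto simp: submodule_def)
    show "\<ominus>\<^bsub>M\<^esub> a \<in> H" if "a \<in> H" for a
    proof -
      have aM: "a \<in> carrier M" using that H submodule.subset by blast
      have "\<ominus>\<^bsub>M\<^esub> a = (\<ominus>\<^bsub>R\<^esub> \<one>\<^bsub>R\<^esub>) \<odot>\<^bsub>M\<^esub> a"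
        using aM M.smult_l_minus[OF M.R.one_closed aM] by simp
      then show ?thesis
        using submodule.smult_closed[OF H _ that, of "\<ominus>\<^bsub>R\<^esub> \<one>\<^bsub>R\<^esub>"] by simp
    qed
    show "a \<oplus>\<^bsub>M\<^esub> b \<in> H" if "a \<in> H" "b \<in> H" for a b
      using that H by (simp add: submodule_def)
  qed
  show "abelian_group M" by (rule M.abelian_group_axioms)
qed

interpretation H: abelian_subgroup H M by (rule abelian_subgroup_H)

lemma quotient_add: "\<lbrakk>x \<in> carrier M; y \<in> carrier M\<rbrakk> \<Longrightarrow>
   (H +>\<^bsub>M\<^esub> x) \<oplus>\<^bsub>quotient_module M H\<^esub> (H +>\<^bsub>M\<^esub> y) = H +>\<^bsub>M\<^esub> (x \<oplus>\<^bsub>M\<^esub> y)"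
  by (simp add: quotient_module_def H.a_rcos_sum)

lemma quotient_smult: assumes "a \<in> carrier R" "x \<in> carrier M"
   shows "a \<odot>\<^bsub>quotient_module M H\<^esub> (H +>\<^bsub>M\<^esub> x) = H +>\<^bsub>M\<^esub> (a \<odot>\<^bsub>M\<^esub> x)"
proof -
  have *: "H +>\<^bsub>M\<^esub> (a \<odot>\<^bsub>M\<^esub> y) = H +>\<^bsub>M\<^esub> (a \<odot>\<^bsub>M\<^esub> x)" if "y \<in> H +>\<^bsub>M\<^esub> x" for y
  proof -
    from that obtain h where h: "h \<in> H" "y = h \<oplus>\<^bsub>M\<^esub> x" by (auto simp: a_r_coset_def')
    have hM: "h \<in> carrier M" using h H.a_subset by auto
    have "a \<odot>\<^bsub>M\<^esub> y = a \<odot>\<^bsub>M\<^esub> h \<oplus>\<^bsub>M\<^esub> a \<odot>\<^bsub>M\<^esub> x"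
      using h hM assms by (simp add: M.smult_r_distr)
    moreover have "a \<odot>\<^bsub>M\<^esub> h \<in> H" using h(1) H assms by (simp add: submodule_def)
    ultimately have "a \<odot>\<^bsub>M\<^esub> y \<in> H +>\<^bsub>M\<^esub> (a \<odot>\<^bsub>M\<^esub> x)" by (auto simp: a_r_coset_def')
    then show ?thesis using H.a_repr_independence'[OF _ M.smult_closed[OF assms]] by simp
  qed
  have "x \<in> H +>\<^bsub>M\<^esub> x" using assms by (simp add: H.a_rcos_self)
  with * have "(\<Union>y\<in>H +>\<^bsub>M\<^esub> x. H +>\<^bsub>M\<^esub> (a \<odot>\<^bsub>M\<^esub> y)) = H +>\<^bsub>M\<^esub> (a \<odot>\<^bsub>M\<^esub> x)" by blast
  then show ?thesis by (simp add: quotient_module_def)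
qed

lemma quotient_zero: "\<zero>\<^bsub>quotient_module M H\<^esub> = H +>\<^bsub>M\<^esub> \<zero>\<^bsub>M\<^esub>"
  using H.a_subset by (simp add: quotient_module_def)

lemma quotient_carrier: "carrier (quotient_module M H) = (\<lambda>x. H +>\<^bsub>M\<^esub> x) ` carrier M"
  by (auto simp: quotient_module_def A_RCOSETS_def')

lemma quotient_is_module: "Module.module R (quotient_module M H)"
proof -
  have c: "H +>\<^bsub>M\<^esub> x \<in> carrier (quotient_module M H)" if "x \<in> carrier M" for x
    using that by (auto simp: quotient_carrier)
  have neg: "\<exists>w\<in>carrier (quotient_module M H). v \<oplus>\<^bsub>quotient_module M H\<^esub> w = \<zero>\<^bsub>quotient_module M H\<^esub>"
    if v: "v \<in> carrier (quotient_module M H)" for v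
  proof -
    obtain x where x: "x \<in> carrier M" "v = H +>\<^bsub>M\<^esub> x" using v by (auto simp: quotient_carrier)
    show ?thesis
      by (rule bexI[where x="H +>\<^bsub>M\<^esub> (\<ominus>\<^bsub>M\<^esub> x)"]) (use x in \<open>simp_all add: c quotient_add quotient_zero M.r_neg\<close>)
  qed
  show ?thesis
    apply (rule module_criteria)
    apply (rule M.R.cring_axioms)
    subgoal by (simp add: quotient_zero c)
    subgoal by (auto simp: quotient_carrier quotient_add)
    subgoal using neg by blast
    subgoal by (auto simp: quotient_carrier quotient_smult)
    subgoal by (auto simp: quotient_carrier quotient_add M.a_comm)
    subgoal by (auto simp: quotient_carrier quotient_add M.a_assoc)
    subgoal by (auto simp: quotient_carrier quotient_add quotient_zero)
    subgoal by (auto simp: quotient_carrier quotient_smult M.smult_assoc1)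
    subgoal by (auto simp: quotient_carrier quotient_smult)
    subgoal by (auto simp: quotient_carrier quotient_add quotient_smult M.smult_l_distr)
    subgoal by (auto simp: quotient_carrier quotient_add quotient_smult M.smult_r_distr)
    done
qed

lemma quotient_proj: "(\<lambda>x. H +>\<^bsub>M\<^esub> x) \<in> LinearCombinations.module_hom R M (quotient_module M H)"
  by (auto simp: LinearCombinations.module_hom_def quotient_carrier quotient_add quotient_smult)

lemma quotient_eqI: assumes "x \<in> carrier M" "y \<in> carrier M" "x \<ominus>\<^bsub>M\<^esub> y \<in> H"
  shows "H +>\<^bsub>M\<^esub> x = H +>\<^bsub>M\<^esub> y"
proof -
  have "x \<in> H +>\<^bsub>M\<^esub> y" using assms H.a_rcos_module[of y x] by (simp add: a_minus_def)
  then show ?thesis using H.a_repr_independence'[OF _ assms(2)] by simp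
qed

end

context
  fixes K :: "('k, 'm) ring_scheme" and W :: "('k, 'w, 'c) module_scheme"
  assumes W: "Module.module K W"
begin

interpretation W: Module.module K W by (fact W)

lemma free_eval_superset:
  assumes f: "f \<in> X \<rightarrow> carrier W" and c: "c \<in> carrier (free_module K X)"
    and S: "finite S" "S \<subseteq> X" "{x. c x \<noteq> \<zero>\<^bsub>K\<^esub>} \<subseteq> S"
  shows "free_eval K W f c = (\<Oplus>\<^bsub>W\<^esub>x\<in>S. c x \<odot>\<^bsub>W\<^esub> f x)"
proof -
  have cl: "c x \<odot>\<^bsub>W\<^esub> f x \<in> carrier W" if "x \<in> S" for x
    using that f c S by (auto simp: free_module_carrier intro!: W.smult_closed)
  have z: "c x \<odot>\<^bsub>W\<^esub> f x = \<zero>\<^bsub>W\<^esub>" if "x \<in> S - {x. c x \<noteq> \<zero>\<^bsub>K\<^esub>}" for x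
  proof -
    have "f x \<in> carrier W" using that S f by blast
    then show ?thesis using that by simp
  qed
  show ?thesis unfolding free_eval_def
    apply (rule W.add.finprod_mono_neutral_cong_left)
    using S cl z by auto
qed

lemma free_eval_hom:
  assumes f: "f \<in> X \<rightarrow> carrier W"
  shows "free_eval K W f \<in> LinearCombinations.module_hom K (free_module K X) W"
proof -
  interpret F: Module.module K "free_module K X" by (rule free_module_is_module[OF W.R.cring_axioms])
  have supp: "finite {x. c x \<noteq> \<zero>\<^bsub>K\<^esub>}" "{x. c x \<noteq> \<zero>\<^bsub>K\<^esub>} \<subseteq> X"
    if "c \<in> carrier (free_module K X)" for c
    using that by (auto simp: free_module_carrier)
  have cK: "c x \<in> carrier K" if "c \<in> carrier (free_module K X)" for c x
    using that by (cases "x \<in> X") (auto simp: free_module_carrier)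
  have fW: "f x \<in> carrier W" if "x \<in> X" for x using f that by auto
  have 1: "free_eval K W f c \<in> carrier W" if c: "c \<in> carrier (free_module K X)" for c
    unfolding free_eval_def
    apply (rule W.finsum_closed) using supp[OF c] cK[OF c] fW by auto
  have 2: "free_eval K W f (c \<oplus>\<^bsub>free_module K X\<^esub> d) = free_eval K W f c \<oplus>\<^bsub>W\<^esub> free_eval K W f d"
    if c: "c \<in> carrier (free_module K X)" and d: "d \<in> carrier (free_module K X)" for c d
  proof -
    let ?S = "{x. c x \<noteq> \<zero>\<^bsub>K\<^esub>} \<union> {x. d x \<noteq> \<zero>\<^bsub>K\<^esub>}"
    have S: "finite ?S" "?S \<subseteq> X" using supp c d by auto
    have cd: "c \<oplus>\<^bsub>free_module K X\<^esub> d \<in> carrier (free_module K X)" using c d by (rule F.a_closed)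
    have "free_eval K W f (c \<oplus>\<^bsub>free_module K X\<^esub> d) = (\<Oplus>\<^bsub>W\<^esub>x\<in>?S. (c x \<oplus>\<^bsub>K\<^esub> d x) \<odot>\<^bsub>W\<^esub> f x)"
      by (subst free_eval_superset[OF f cd S]) auto
    also have "\<dots> = (\<Oplus>\<^bsub>W\<^esub>x\<in>?S. c x \<odot>\<^bsub>W\<^esub> f x \<oplus>\<^bsub>W\<^esub> d x \<odot>\<^bsub>W\<^esub> f x)"
      apply (rule W.finsum_cong')
      using S cK[OF c] cK[OF d] fW by (auto simp: W.smult_l_distr intro!: W.a_closed W.smult_closed)
    also have "\<dots> = (\<Oplus>\<^bsub>W\<^esub>x\<in>?S. c x \<odot>\<^bsub>W\<^esub> f x) \<oplus>\<^bsub>W\<^esub> (\<Oplus>\<^bsub>W\<^esub>x\<in>?S. d x \<odot>\<^bsub>W\<^esub> f x)"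
      apply (rule W.finsum_addf)
      using S cK[OF c] cK[OF d] fW by (auto intro!: W.smult_closed)
    also have "\<dots> = free_eval K W f c \<oplus>\<^bsub>W\<^esub> free_eval K W f d"
      by (subst (1 2) free_eval_superset[OF f _ S]) (use c d in auto)
    finally show ?thesis .
  qed
  have 3: "free_eval K W f (a \<odot>\<^bsub>free_module K X\<^esub> c) = a \<odot>\<^bsub>W\<^esub> free_eval K W f c"
    if a: "a \<in> carrier K" and c: "c \<in> carrier (free_module K X)" for a c
  proof -
    let ?S = "{x. c x \<noteq> \<zero>\<^bsub>K\<^esub>}"
    have S: "finite ?S" "?S \<subseteq> X" using supp c by auto
    have ac: "a \<odot>\<^bsub>free_module K X\<^esub> c \<in> carrier (free_module K X)" using a c by (rule F.smult_closed)
    have "free_eval K W f (a \<odot>\<^bsub>free_module K X\<^esub> c) = (\<Oplus>\<^bsub>W\<^esub>x\<in>?S. (a \<otimes>\<^bsub>K\<^esub> c x) \<odot>\<^bsub>W\<^esub> f x)"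
      by (subst free_eval_superset[OF f ac S]) (use a in auto)
    also have "\<dots> = (\<Oplus>\<^bsub>W\<^esub>x\<in>?S. a \<odot>\<^bsub>W\<^esub> (c x \<odot>\<^bsub>W\<^esub> f x))"
      apply (rule W.finsum_cong')
      using S a cK[OF c] fW by (auto simp: W.smult_assoc1 intro!: W.smult_closed)
    also have "\<dots> = a \<odot>\<^bsub>W\<^esub> free_eval K W f c" unfolding free_eval_def
      apply (rule W.finsum_smult[symmetric])
      using S a cK[OF c] fW by auto
    finally show ?thesis .
  qed
  show ?thesis using 1 2 3 by (auto simp: LinearCombinations.module_hom_def)
qed

lemma free_eval_gen:
  assumes "\<one>\<^bsub>K\<^esub> \<noteq> \<zero>\<^bsub>K\<^esub>" "f x \<in> carrier W"
  shows "free_eval K W f (free_gen K x) = f x"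
proof -
  have "{y. free_gen K x y \<noteq> \<zero>\<^bsub>K\<^esub>} = {x}" using assms by (auto simp: free_gen_def)
  then show ?thesis using assms by (simp add: free_eval_def free_gen_def)
qed

lemma module_hom_zero: "Module.module K V \<Longrightarrow> h \<in> LinearCombinations.module_hom K V W \<Longrightarrow> h \<zero>\<^bsub>V\<^esub> = \<zero>\<^bsub>W\<^esub>"
  by (rule mod_hom.f0_is_0) (auto simp: mod_hom_def mod_hom_axioms_def W)

lemma free_hom_ext:
  assumes h: "h \<in> LinearCombinations.module_hom K (free_module K X) W" and g: "g \<in> LinearCombinations.module_hom K (free_module K X) W"
    and eq: "\<And>x. x \<in> X \<Longrightarrow> h (free_gen K x) = g (free_gen K x)"
    and c: "c \<in> carrier (free_module K X)"
  shows "h c = g c"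
proof -
  interpret F: Module.module K "free_module K X" by (rule free_module_is_module[OF W.R.cring_axioms])
  have "finite S \<Longrightarrow> S \<subseteq> X \<Longrightarrow> \<forall>c. c \<in> carrier (free_module K X) \<longrightarrow> {x. c x \<noteq> \<zero>\<^bsub>K\<^esub>} \<subseteq> S \<longrightarrow> h c = g c" for S
  proof (induction S rule: finite_induct)
    case empty
    have "c = \<zero>\<^bsub>free_module K X\<^esub>" if "{x. c x \<noteq> \<zero>\<^bsub>K\<^esub>} \<subseteq> {}" for c using that by auto
    then show ?case using module_hom_zero[OF F.module_axioms h] module_hom_zero[OF F.module_axioms g] by metis
  next
    case (insert x S)
    show ?case
    proof (intro allI impI)
      fix c assume c: "c \<in> carrier (free_module K X)" and s: "{x. c x \<noteq> \<zero>\<^bsub>K\<^esub>} \<subseteq> insert x S"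
      let ?d = "c(x := \<zero>\<^bsub>K\<^esub>)"
      have cK: "c y \<in> carrier K" for y
        using c by (cases "y \<in> X") (auto simp: free_module_carrier)
      have d: "?d \<in> carrier (free_module K X)"
        using c insert.prems by (auto simp: free_module_carrier elim!: finite_subset[rotated])
      have x: "free_gen K x \<in> carrier (free_module K X)"
        using insert.prems by (intro free_gen_carrier W.R.cring_axioms) auto
      have ax: "c x \<odot>\<^bsub>free_module K X\<^esub> free_gen K x \<in> carrier (free_module K X)"
        using cK x by (rule F.smult_closed)
      have ceq: "c = ?d \<oplus>\<^bsub>free_module K X\<^esub> (c x \<odot>\<^bsub>free_module K X\<^esub> free_gen K x)"
        using cK by (auto simp: free_gen_def)
      have "{y. ?d y \<noteq> \<zero>\<^bsub>K\<^esub>} \<subseteq> S" using s by auto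
      then have "h ?d = g ?d" using insert.IH insert.prems d by blast
      then show "h c = g c"
        apply (subst (1 2) ceq)
        using eq[of x] insert.prems h g d ax x cK
        by (simp add: LinearCombinations.module_hom_add[OF h d ax] LinearCombinations.module_hom_add[OF g d ax]
          LinearCombinations.module_hom_smult[OF h cK x] LinearCombinations.module_hom_smult[OF g cK x] del: free_module_simps)
    qed
  qed
  then show ?thesis using c by (auto simp: free_module_carrier)
qed

end

lemma module_hom_comp: "f \<in> LinearCombinations.module_hom K U V \<Longrightarrow> g \<in> LinearCombinations.module_hom K V W \<Longrightarrow> (\<lambda>x. g (f x)) \<in> LinearCombinations.module_hom K U W"
  by (auto simp: LinearCombinations.module_hom_def Pi_iff)

context
  fixes K :: "('k, 'm) ring_scheme" and U :: "('k, 'u, 'a) module_scheme"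
    and V :: "('k, 'v, 'b) module_scheme"
  assumes U: "vectorspace K U" and V: "vectorspace K V"
begin

interpretation U: vectorspace K U by (fact U)
interpretation V: vectorspace K V by (fact V)

private abbreviation "F \<equiv> free_module K (carrier U \<times> carrier V)"

private lemma F_module: "Module.module K F" by (rule free_module_is_module[OF U.R.cring_axioms])

interpretation F: Module.module K F by (rule F_module)

private lemma gen_cl: "u \<in> carrier U \<Longrightarrow> v \<in> carrier V \<Longrightarrow> free_gen K (u, v) \<in> carrier F"
  by (intro free_gen_carrier U.R.cring_axioms) auto

lemma relators_carrier: "tensor_relators K U V \<subseteq> carrier F"
  unfolding tensor_relators_def Let_def
  by (auto simp del: free_module_simps intro!: F.minus_closed F.a_closed F.smult_closed gen_cl)

lemma null_submodule: "submodule K (tensor_null K U V) F"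
  unfolding tensor_null_def by (rule F.span_is_submodule[OF relators_carrier])

lemma relators_null: "tensor_relators K U V \<subseteq> tensor_null K U V"
  unfolding tensor_null_def by (rule F.in_own_span[OF relators_carrier])

lemma tensor_module: "Module.module K (tensor K U V)"
  unfolding tensor_def by (rule quotient_is_module[OF F_module null_submodule])

lemma tensor_vectorspace: "vectorspace K (tensor K U V)"
  by (simp add: vectorspace_def tensor_module U.field_axioms)

lemma tensor_carrier: "carrier (tensor K U V) = (\<lambda>x. tensor_null K U V +>\<^bsub>F\<^esub> x) ` carrier F"
  unfolding tensor_def by (rule quotient_carrier[OF F_module null_submodule])

private lemma proj_hom: "(\<lambda>x. tensor_null K U V +>\<^bsub>F\<^esub> x) \<in> LinearCombinations.module_hom K F (tensor K U V)"
  unfolding tensor_def by (rule quotient_proj[OF F_module null_submodule])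

private lemma rel_eq: "x \<ominus>\<^bsub>F\<^esub> y \<in> tensor_relators K U V \<Longrightarrow> x \<in> carrier F \<Longrightarrow> y \<in> carrier F \<Longrightarrow>
   tensor_null K U V +>\<^bsub>F\<^esub> x = tensor_null K U V +>\<^bsub>F\<^esub> y"
  by (rule quotient_eqI[OF F_module null_submodule]) (use relators_null in auto)

lemma pure_tensor_bilinear: "bilinear_map K U V (tensor K U V) (pure_tensor K U V)"
proof -
  note add = LinearCombinations.module_hom_add[OF proj_hom, symmetric] and sm = LinearCombinations.module_hom_smult[OF proj_hom, symmetric]
  have cl: "pure_tensor K U V u v \<in> carrier (tensor K U V)" if "u \<in> carrier U" "v \<in> carrier V" for u v
    using that gen_cl by (auto simp: tensor_carrier pure_tensor_def)
  let ?T = "tensor K U V" and ?p = "pure_tensor K U V"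
  have 1: "?p (u \<oplus>\<^bsub>U\<^esub> u') v = ?p u v \<oplus>\<^bsub>?T\<^esub> ?p u' v"
    if "u \<in> carrier U" "u' \<in> carrier U" "v \<in> carrier V" for u u' v
    unfolding pure_tensor_def add[OF gen_cl[OF that(1,3)] gen_cl[OF that(2,3)]]
    apply (rule rel_eq)
    subgoal unfolding tensor_relators_def Let_def using that by blast
    using that by (simp_all add: gen_cl F.a_closed U.M.a_closed del: free_module_simps)
  have 2: "?p u (v \<oplus>\<^bsub>V\<^esub> v') = ?p u v \<oplus>\<^bsub>?T\<^esub> ?p u v'"
    if "u \<in> carrier U" "v \<in> carrier V" "v' \<in> carrier V" for u v v'
    unfolding pure_tensor_def add[OF gen_cl[OF that(1,2)] gen_cl[OF that(1,3)]]
    apply (rule rel_eq)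
    subgoal unfolding tensor_relators_def Let_def using that by blast
    using that by (simp_all add: gen_cl F.a_closed V.M.a_closed del: free_module_simps)
  have 3: "?p (a \<odot>\<^bsub>U\<^esub> u) v = a \<odot>\<^bsub>?T\<^esub> ?p u v"
    if "a \<in> carrier K" "u \<in> carrier U" "v \<in> carrier V" for a u v
    unfolding pure_tensor_def sm[OF that(1) gen_cl[OF that(2,3)]]
    apply (rule rel_eq)
    subgoal unfolding tensor_relators_def Let_def using that by blast
    using that by (simp_all add: gen_cl F.smult_closed U.smult_closed del: free_module_simps)
  have 4: "?p u (a \<odot>\<^bsub>V\<^esub> v) = a \<odot>\<^bsub>?T\<^esub> ?p u v"
    if "a \<in> carrier K" "u \<in> carrier U" "v \<in> carrier V" for a u v
    unfolding pure_tensor_def sm[OF that(1) gen_cl[OF that(2,3)]]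
    apply (rule rel_eq)
    subgoal unfolding tensor_relators_def Let_def using that by blast
    using that by (simp_all add: gen_cl F.smult_closed V.smult_closed del: free_module_simps)
  show ?thesis unfolding bilinear_map_def LinearCombinations.module_hom_def
    by (simp add: cl 1 2 3 4)
qed

lemma tensor_hom_ext:
  assumes W: "Module.module K W" and h: "h \<in> LinearCombinations.module_hom K (tensor K U V) W" and g: "g \<in> LinearCombinations.module_hom K (tensor K U V) W"
    and eq: "\<And>u v. u \<in> carrier U \<Longrightarrow> v \<in> carrier V \<Longrightarrow> h (pure_tensor K U V u v) = g (pure_tensor K U V u v)"
    and t: "t \<in> carrier (tensor K U V)"
  shows "h t = g t"
proof -
  obtain c where c: "c \<in> carrier F" "t = tensor_null K U V +>\<^bsub>F\<^esub> c" using t by (auto simp: tensor_carrier)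
  show ?thesis unfolding c(2)
    by (rule free_hom_ext[OF W module_hom_comp[OF proj_hom h] module_hom_comp[OF proj_hom g] _ c(1)])
       (use eq in \<open>auto simp: pure_tensor_def\<close>)
qed

context
  fixes W :: "('k, 'w, 'c) module_scheme" and f
  assumes W: "Module.module K W" and f: "bilinear_map K U V W f"
begin

interpretation W: Module.module K W by (fact W)

private abbreviation "E \<equiv> free_eval K W (\<lambda>(u, v). f u v)"

private lemma f_cl: "u \<in> carrier U \<Longrightarrow> v \<in> carrier V \<Longrightarrow> f u v \<in> carrier W"
  using f by (auto simp: bilinear_map_def LinearCombinations.module_hom_def)

private lemma E_hom: "E \<in> LinearCombinations.module_hom K F W"
  by (rule free_eval_hom[OF W]) (auto intro: f_cl)

private lemma E_gen: "u \<in> carrier U \<Longrightarrow> v \<in> carrier V \<Longrightarrow> E (free_gen K (u, v)) = f u v"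
  using U.one_not_zero by (subst free_eval_gen[OF W]) (auto intro: f_cl)

private lemma E_null: "r \<in> tensor_null K U V \<Longrightarrow> E r = \<zero>\<^bsub>W\<^esub>"
proof -
  interpret E: mod_hom K F W E
    using F_module W E_hom by (simp add: mod_hom_def mod_hom_axioms_def)
  have m: "E (x \<ominus>\<^bsub>F\<^esub> y) = \<zero>\<^bsub>W\<^esub>" if "x \<in> carrier F" "y \<in> carrier F" "E x = E y" for x y
    using that E.f_minus[of x y] by (simp add: W.r_neg a_minus_def del: free_module_simps)
  have "tensor_relators K U V \<subseteq> E.ker"
  proof
    fix r assume r: "r \<in> tensor_relators K U V"
    have f1: "f (u \<oplus>\<^bsub>U\<^esub> u') v = f u v \<oplus>\<^bsub>W\<^esub> f u' v"
      if "u \<in> carrier U" "u' \<in> carrier U" "v \<in> carrier V" for u u' v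
      using f that by (simp add: bilinear_map_def LinearCombinations.module_hom_def)
    have f2: "f u (v \<oplus>\<^bsub>V\<^esub> v') = f u v \<oplus>\<^bsub>W\<^esub> f u v'"
      if "u \<in> carrier U" "v \<in> carrier V" "v' \<in> carrier V" for u v v'
      using f that by (simp add: bilinear_map_def LinearCombinations.module_hom_def)
    have f3: "f (a \<odot>\<^bsub>U\<^esub> u) v = a \<odot>\<^bsub>W\<^esub> f u v"
      if "a \<in> carrier K" "u \<in> carrier U" "v \<in> carrier V" for a u v
      using f that by (simp add: bilinear_map_def LinearCombinations.module_hom_def)
    have f4: "f u (a \<odot>\<^bsub>V\<^esub> v) = a \<odot>\<^bsub>W\<^esub> f u v"
      if "a \<in> carrier K" "u \<in> carrier U" "v \<in> carrier V" for a u v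
      using f that by (simp add: bilinear_map_def LinearCombinations.module_hom_def)
    note Es = LinearCombinations.module_hom_add[OF E_hom] LinearCombinations.module_hom_smult[OF E_hom]
    have "E r = \<zero>\<^bsub>W\<^esub>"
      using r unfolding tensor_relators_def Let_def
      by (elim UnE CollectE exE conjE; hypsubst; intro m)
         (simp_all add: Es E_gen gen_cl f1 f2 f3 f4 F.a_closed F.smult_closed
            del: free_module_simps)
    then show "r \<in> E.ker" using r relators_carrier by (auto simp: E.ker_def)
  qed
  then have "tensor_null K U V \<subseteq> E.ker"
    unfolding tensor_null_def by (rule F.span_is_subset[OF _ E.ker_is_submodule])
  then show "r \<in> tensor_null K U V \<Longrightarrow> E r = \<zero>\<^bsub>W\<^esub>" by (auto simp: E.ker_def)
qed

private lemma lift_coset: assumes c: "c \<in> carrier F"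
  shows "tensor_lift K W f (tensor_null K U V +>\<^bsub>F\<^esub> c) = E c"
proof -
  have n: "tensor_null K U V \<subseteq> carrier F" using null_submodule by (simp add: submodule_def)
  have "E (r \<oplus>\<^bsub>F\<^esub> c) = E c" if "r \<in> tensor_null K U V" for r
  proof -
    have "E c \<in> carrier W" using c LinearCombinations.module_hom_closed[OF E_hom] by blast
    then show ?thesis
      using n that by (subst LinearCombinations.module_hom_add[OF E_hom _ c]) (auto simp: E_null)
  qed
  moreover have "tensor_null K U V \<noteq> {}" using null_submodule by (auto simp: submodule_def)
  ultimately have "E ` (tensor_null K U V +>\<^bsub>F\<^esub> c) = {E c}"
    unfolding a_r_coset_def' image_UN by (simp del: free_module_simps)
  then show ?thesis by (simp add: tensor_lift_def)
qed

lemma tensor_lift_pure: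
  "u \<in> carrier U \<Longrightarrow> v \<in> carrier V \<Longrightarrow> tensor_lift K W f (pure_tensor K U V u v) = f u v"
  by (simp add: pure_tensor_def lift_coset gen_cl E_gen)

lemma tensor_lift_hom: "tensor_lift K W f \<in> LinearCombinations.module_hom K (tensor K U V) W"
proof -
  let ?L = "tensor_lift K W f"
  have E: "E c \<in> carrier W" if "c \<in> carrier F" for c
    using E_hom that by (auto dest: LinearCombinations.module_hom_closed)
  have add: "?L ((tensor_null K U V +>\<^bsub>F\<^esub> c) \<oplus>\<^bsub>tensor K U V\<^esub> (tensor_null K U V +>\<^bsub>F\<^esub> d)) = E c \<oplus>\<^bsub>W\<^esub> E d"
    if "c \<in> carrier F" "d \<in> carrier F" for c d
    unfolding LinearCombinations.module_hom_add[OF proj_hom that, symmetric]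
      lift_coset[OF F.a_closed[OF that]] LinearCombinations.module_hom_add[OF E_hom that] ..
  have smult: "?L (a \<odot>\<^bsub>tensor K U V\<^esub> (tensor_null K U V +>\<^bsub>F\<^esub> c)) = a \<odot>\<^bsub>W\<^esub> E c"
    if "a \<in> carrier K" "c \<in> carrier F" for a c
    unfolding LinearCombinations.module_hom_smult[OF proj_hom that, symmetric]
      lift_coset[OF F.smult_closed[OF that]] LinearCombinations.module_hom_smult[OF E_hom that] ..
  show ?thesis unfolding LinearCombinations.module_hom_def tensor_carrier
    by (simp add: lift_coset E add smult Pi_iff)
       (auto simp: lift_coset E add smult simp del: free_module_simps)
qed

end
end


section \<open>Shelf cohomology in coalgebras\<close>

text \<open>The differentials at \<open>(\<eta>, 0)\<close> for a space \<open>N\<close> with linear maps \<open>\<Delta> : N \<rightarrow> N \<otimes> N\<close> and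
  \<open>q : N \<otimes> N \<rightarrow> N\<close>, where \<open>N\<^sup>\<otimes>\<^sup>3\<close> is \<open>(N \<otimes> N) \<otimes> N\<close> and \<open>N\<^sup>\<otimes>\<^sup>4\<close> is \<open>(N \<otimes> N) \<otimes> (N \<otimes> N)\<close>. In
  \<open>d21\<close> the map \<open>1 \<otimes> 1 \<otimes> \<Delta>\<close> is the tensor product of the identity of \<open>N \<otimes> N\<close> with \<open>\<Delta>\<close>.\<close>

definition d21 ::
  "('k, 'm) ring_scheme \<Rightarrow> ('k, 'v, 'a) module_scheme \<Rightarrow> ('v \<Rightarrow> ('v \<times> 'v \<Rightarrow> 'k) set) \<Rightarrow>
   (('v \<times> 'v \<Rightarrow> 'k) set \<Rightarrow> 'v) \<Rightarrow> (('v \<times> 'v \<Rightarrow> 'k) set \<Rightarrow> 'v) \<Rightarrow>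
   (('v \<times> 'v \<Rightarrow> 'k) set \<times> 'v \<Rightarrow> 'k) set \<Rightarrow> 'v" where
  "d21 K N \<Delta> q \<eta> t =
     (let N2 = tensor K N N;
          s = tensor_flip_mid K N (tensor_map K N2 N2 (\<lambda>x. x) \<Delta> t)
      in (q (tensor_map K N N \<eta> (\<lambda>x. x) t) \<oplus>\<^bsub>N\<^esub> \<eta> (tensor_map K N N q (\<lambda>x. x) t))
         \<ominus>\<^bsub>N\<^esub> (\<eta> (tensor_map K N N q q s) \<oplus>\<^bsub>N\<^esub> q (tensor_map K N N \<eta> q s)
              \<oplus>\<^bsub>N\<^esub> q (tensor_map K N N q \<eta> s)))"

definition d22 ::
  "('k, 'm) ring_scheme \<Rightarrow> ('k, 'v, 'a) module_scheme \<Rightarrow> ('v \<Rightarrow> ('v \<times> 'v \<Rightarrow> 'k) set) \<Rightarrow>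
   (('v \<times> 'v \<Rightarrow> 'k) set \<Rightarrow> 'v) \<Rightarrow> (('v \<times> 'v \<Rightarrow> 'k) set \<Rightarrow> 'v) \<Rightarrow>
   ('v \<times> 'v \<Rightarrow> 'k) set \<Rightarrow> ('v \<times> 'v \<Rightarrow> 'k) set" where
  "d22 K N \<Delta> q \<eta> t =
     (let N2 = tensor K N N;
          s = tensor_flip_mid K N (tensor_map K N2 N2 \<Delta> \<Delta> t)
      in \<Delta> (\<eta> t) \<ominus>\<^bsub>N2\<^esub> (tensor_map K N N \<eta> q s \<oplus>\<^bsub>N2\<^esub> tensor_map K N N q \<eta> s))"

definition shelf_2_cocycle ::
  "('k, 'm) ring_scheme \<Rightarrow> ('k, 'v, 'a) module_scheme \<Rightarrow> ('v \<Rightarrow> ('v \<times> 'v \<Rightarrow> 'k) set) \<Rightarrow>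
   (('v \<times> 'v \<Rightarrow> 'k) set \<Rightarrow> 'v) \<Rightarrow> (('v \<times> 'v \<Rightarrow> 'k) set \<Rightarrow> 'v) \<Rightarrow> bool" where
  "shelf_2_cocycle K N \<Delta> q \<eta> \<longleftrightarrow>
     \<eta> \<in> LinearCombinations.module_hom K (tensor K N N) N \<and>
     (\<forall>t\<in>carrier (tensor K (tensor K N N) N). d21 K N \<Delta> q \<eta> t = \<zero>\<^bsub>N\<^esub>) \<and>
     (\<forall>t\<in>carrier (tensor K N N). d22 K N \<Delta> q \<eta> t = \<zero>\<^bsub>tensor K N N\<^esub>)"


section \<open>Lie algebras and the coalgebra \<open>N = k \<oplus> \<gg>\<close>\<close>

locale lie_algebra = vectorspace K L
  for K :: "('k, 'm) ring_scheme" and L :: "('k, 'g, 'n) module_scheme" +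
  fixes bracket :: "'g \<Rightarrow> 'g \<Rightarrow> 'g"
  assumes bracket_bilinear: "bilinear_map K L L L bracket"
    and bracket_alternating: "x \<in> carrier L \<Longrightarrow> bracket x x = \<zero>\<^bsub>L\<^esub>"
    and jacobi: "\<lbrakk>x \<in> carrier L; y \<in> carrier L; z \<in> carrier L\<rbrakk> \<Longrightarrow>
      bracket (bracket x y) z \<oplus>\<^bsub>L\<^esub> bracket (bracket y z) x \<oplus>\<^bsub>L\<^esub> bracket (bracket z x) y = \<zero>\<^bsub>L\<^esub>"

definition lie_2_cocycle ::
  "('k, 'm) ring_scheme \<Rightarrow> ('k, 'g, 'n) module_scheme \<Rightarrow> ('g \<Rightarrow> 'g \<Rightarrow> 'g) \<Rightarrow>
   ('g \<Rightarrow> 'g \<Rightarrow> 'g) \<Rightarrow> bool" where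
  "lie_2_cocycle K L bracket \<psi> \<longleftrightarrow>
     bilinear_map K L L L \<psi> \<and>
     (\<forall>x\<in>carrier L. \<forall>y\<in>carrier L. \<psi> y x = \<ominus>\<^bsub>L\<^esub> \<psi> x y) \<and>
     (\<forall>x\<in>carrier L. \<forall>y\<in>carrier L. \<forall>z\<in>carrier L.
        bracket (\<psi> x y) z \<oplus>\<^bsub>L\<^esub> bracket (\<psi> y z) x \<oplus>\<^bsub>L\<^esub> bracket (\<psi> z x) y \<oplus>\<^bsub>L\<^esub>
        \<psi> (bracket x y) z \<oplus>\<^bsub>L\<^esub> \<psi> (bracket y z) x \<oplus>\<^bsub>L\<^esub> \<psi> (bracket z x) y = \<zero>\<^bsub>L\<^esub>)"

text \<open>The pair \<open>(a, x)\<close> stands for \<open>a + x\<close>.\<close>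

definition lie_ext ::
  "('k, 'm) ring_scheme \<Rightarrow> ('k, 'g, 'n) module_scheme \<Rightarrow> ('k, 'k \<times> 'g) module" where
  "lie_ext K L = direct_sum (self_module K) L"

definition lie_comult ::
  "('k, 'm) ring_scheme \<Rightarrow> ('k, 'g, 'n) module_scheme \<Rightarrow> 'k \<times> 'g \<Rightarrow>
   (('k \<times> 'g) \<times> ('k \<times> 'g) \<Rightarrow> 'k) set" where
  "lie_comult K L = (\<lambda>(a, x).
     let N = lie_ext K L; N2 = tensor K N N; e = (\<one>\<^bsub>K\<^esub>, \<zero>\<^bsub>L\<^esub>); x' = (\<zero>\<^bsub>K\<^esub>, x) in
     a \<odot>\<^bsub>N2\<^esub> pure_tensor K N N e e \<oplus>\<^bsub>N2\<^esub> (pure_tensor K N N x' e \<oplus>\<^bsub>N2\<^esub> pure_tensor K N N e x'))"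

definition lie_counit :: "'k \<times> 'g \<Rightarrow> 'k" where
  "lie_counit = fst"

definition lie_q ::
  "('k, 'm) ring_scheme \<Rightarrow> ('k, 'g, 'n) module_scheme \<Rightarrow> ('g \<Rightarrow> 'g \<Rightarrow> 'g) \<Rightarrow>
   (('k \<times> 'g) \<times> ('k \<times> 'g) \<Rightarrow> 'k) set \<Rightarrow> 'k \<times> 'g" where
  "lie_q K L bracket = tensor_lift K (lie_ext K L)
     (\<lambda>(a, x) (b, y). (a \<otimes>\<^bsub>K\<^esub> b, b \<odot>\<^bsub>L\<^esub> x \<oplus>\<^bsub>L\<^esub> bracket x y))"

definition lie_cocycle_hat ::
  "('k, 'm) ring_scheme \<Rightarrow> ('k, 'g, 'n) module_scheme \<Rightarrow> ('g \<Rightarrow> 'g \<Rightarrow> 'g) \<Rightarrow>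
   (('k \<times> 'g) \<times> ('k \<times> 'g) \<Rightarrow> 'k) set \<Rightarrow> 'k \<times> 'g" where
  "lie_cocycle_hat K L \<psi> = tensor_lift K (lie_ext K L) (\<lambda>(a, x) (b, y). (\<zero>\<^bsub>K\<^esub>, \<psi> x y))"

end

theory Submission
  imports Defs
begin

text \<open>
  Both differentials are linear maps on tensor powers of \<open>N = k \<oplus> \<gg>\<close>, so their vanishing can be
  tested on pure tensors, with \<open>X = a + x\<close>, \<open>Y = b + y\<close>, \<open>Z = c + z\<close>. There the comultiplication
  \<open>\<Delta>(c + z) = c(1 \<otimes> 1) + (z \<otimes> 1 + 1 \<otimes> z)\<close> splits each term into three, and few of the summands
  survive, because \<open>\<eta>\<close> (which is \<open>\<psi>\<close> extended to \<open>N\<close>) kills a tensor with a factor \<open>1\<close>, while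
  \<open>q(X \<otimes> 1) = X\<close> and \<open>q(1 \<otimes> y) = 0\<close> for \<open>y \<in> \<gg>\<close>.

  For \<open>d21\<close>, the positive terms sum to
  \<open>c\<psi>(x,y) + b\<psi>(x,z) + [\<psi>(x,y),z] + \<psi>([x,y],z)\<close> and the negative ones to
  \<open>c\<psi>(x,y) + b\<psi>(x,z) + \<psi>([x,z],y) + \<psi>(x,[y,z]) + [\<psi>(x,z),y] + [x,\<psi>(y,z)]\<close>. The scalar terms
  agree, and by antisymmetry of \<open>\<psi>\<close> and of the bracket the equality of the rest is the Lie cocycle
  identity written as a derivation-like rule (\<open>cocycle_eq\<close>). For \<open>d22\<close>, of the nine summands of
  \<open>(\<eta> \<otimes> q)\<tau>\<^sub>2(\<Delta>X \<otimes> \<Delta>Y)\<close> only \<open>\<psi>(x,y) \<otimes> 1\<close> remains, and symmetrically \<open>1 \<otimes> \<psi>(x,y)\<close> for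
  \<open>q \<otimes> \<eta>\<close>; together they are \<open>\<Delta>(\<psi>(x,y))\<close>, as \<open>\<psi>(x,y)\<close> is primitive.

  What needs work beyond this computation is that all the maps involved are linear with the expected
  values on pure tensors. The delicate one is \<open>\<tau>\<^sub>2\<close>, a map on four factors that is built by nested
  extension of bilinear maps; its linearity rests on \<open>tensor_lift_parameter_hom\<close>.
\<close>

section \<open>Linear maps\<close>

abbreviation linear_maps ::
  "('k, 'm) ring_scheme \<Rightarrow> ('k, 'u, 'a) module_scheme \<Rightarrow> ('k, 'v, 'b) module_scheme \<Rightarrow> ('u \<Rightarrow> 'v) set"
  where "linear_maps K U V \<equiv> LinearCombinations.module_hom K U V"

lemma linear_mapsI:
  assumes "\<And>u. u \<in> carrier U \<Longrightarrow> f u \<in> carrier V"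
    and "\<And>u u'. u \<in> carrier U \<Longrightarrow> u' \<in> carrier U \<Longrightarrow> f (u \<oplus>\<^bsub>U\<^esub> u') = f u \<oplus>\<^bsub>V\<^esub> f u'"
    and "\<And>a u. a \<in> carrier K \<Longrightarrow> u \<in> carrier U \<Longrightarrow> f (a \<odot>\<^bsub>U\<^esub> u) = a \<odot>\<^bsub>V\<^esub> f u"
  shows "f \<in> linear_maps K U V"
  using assms by (auto simp: LinearCombinations.module_hom_def)

lemma linear_mapsD:
  assumes "f \<in> linear_maps K U V"
  shows "u \<in> carrier U \<Longrightarrow> f u \<in> carrier V"
    and "u \<in> carrier U \<Longrightarrow> u' \<in> carrier U \<Longrightarrow> f (u \<oplus>\<^bsub>U\<^esub> u') = f u \<oplus>\<^bsub>V\<^esub> f u'"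
    and "a \<in> carrier K \<Longrightarrow> u \<in> carrier U \<Longrightarrow> f (a \<odot>\<^bsub>U\<^esub> u) = a \<odot>\<^bsub>V\<^esub> f u"
  using assms by (auto simp: LinearCombinations.module_hom_def)

lemma linear_maps_id: "(\<lambda>u. u) \<in> linear_maps K U U"
  by (rule linear_mapsI) simp_all

lemma linear_maps_sum:
  assumes W: "Module.module K W" and f: "f \<in> linear_maps K U W" and g: "g \<in> linear_maps K U W"
  shows "(\<lambda>u. f u \<oplus>\<^bsub>W\<^esub> g u) \<in> linear_maps K U W"
proof -
  interpret W: Module.module K W by fact
  show ?thesis
    by (rule linear_mapsI)
       (simp_all add: linear_mapsD[OF f] linear_mapsD[OF g] W.a_ac W.smult_r_distr)
qed

lemma linear_maps_scaled:
  assumes W: "Module.module K W" and a: "a \<in> carrier K" and f: "f \<in> linear_maps K U W"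
  shows "(\<lambda>u. a \<odot>\<^bsub>W\<^esub> f u) \<in> linear_maps K U W"
proof -
  interpret W: Module.module K W by fact
  show ?thesis
    by (rule linear_mapsI)
       (simp_all add: linear_mapsD[OF f] a W.smult_r_distr W.R.m_comm flip: W.smult_assoc1)
qed

lemma bilinear_mapI:
  assumes "\<And>u. u \<in> carrier U \<Longrightarrow> (\<lambda>v. f u v) \<in> linear_maps K V W"
    and "\<And>v. v \<in> carrier V \<Longrightarrow> (\<lambda>u. f u v) \<in> linear_maps K U W"
  shows "bilinear_map K U V W f"
  using assms by (simp add: bilinear_map_def)

lemma bilinear_mapD:
  assumes "bilinear_map K U V W f"
  shows "u \<in> carrier U \<Longrightarrow> (\<lambda>v. f u v) \<in> linear_maps K V W"
    and "v \<in> carrier V \<Longrightarrow> (\<lambda>u. f u v) \<in> linear_maps K U W"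
  using assms by (simp_all add: bilinear_map_def)

lemma bilinear_map_closed:
  assumes "bilinear_map K U V W f" "u \<in> carrier U" "v \<in> carrier V"
  shows "f u v \<in> carrier W"
  using linear_mapsD(1)[OF bilinear_mapD(1)] assms by metis

lemma bilinear_map_zero:
  assumes "Module.module K U" "Module.module K V" "Module.module K W" "bilinear_map K U V W f"
  shows "v \<in> carrier V \<Longrightarrow> f \<zero>\<^bsub>U\<^esub> v = \<zero>\<^bsub>W\<^esub>"
    and "u \<in> carrier U \<Longrightarrow> f u \<zero>\<^bsub>V\<^esub> = \<zero>\<^bsub>W\<^esub>"
  using module_hom_zero[OF assms(3) assms(1) bilinear_mapD(2)[OF assms(4)]]
    module_hom_zero[OF assms(3) assms(2) bilinear_mapD(1)[OF assms(4)]] by blast+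

lemma bilinear_map_comp:
  assumes B: "bilinear_map K U V W B"
    and f: "f \<in> linear_maps K U' U" and g: "g \<in> linear_maps K V' V"
  shows "bilinear_map K U' V' W (\<lambda>u v. B (f u) (g v))"
proof (rule bilinear_mapI)
  fix u assume "u \<in> carrier U'"
  then show "(\<lambda>v. B (f u) (g v)) \<in> linear_maps K V' W"
    using module_hom_comp[OF g bilinear_mapD(1)[OF B]] linear_mapsD(1)[OF f] by blast
next
  fix v assume "v \<in> carrier V'"
  then show "(\<lambda>u. B (f u) (g v)) \<in> linear_maps K U' W"
    using module_hom_comp[OF f bilinear_mapD(2)[OF B]] linear_mapsD(1)[OF g] by blast
qed


section \<open>Linear maps on tensor products\<close>

lemma tensor_map_hom:
  assumes "vectorspace K U" "vectorspace K V" "vectorspace K U'" "vectorspace K V'"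
    and "f \<in> linear_maps K U U'" "g \<in> linear_maps K V V'"
  shows "tensor_map K U' V' f g \<in> linear_maps K (tensor K U V) (tensor K U' V')"
  unfolding tensor_map_def
  by (intro tensor_lift_hom tensor_module bilinear_map_comp[OF pure_tensor_bilinear] assms)

lemma tensor_map_pure:
  assumes "vectorspace K U" "vectorspace K V" "vectorspace K U'" "vectorspace K V'"
    and "f \<in> linear_maps K U U'" "g \<in> linear_maps K V V'"
    and "u \<in> carrier U" "v \<in> carrier V"
  shows "tensor_map K U' V' f g (pure_tensor K U V u v) = pure_tensor K U' V' (f u) (g v)"
  unfolding tensor_map_def
  by (intro tensor_lift_pure tensor_module bilinear_map_comp[OF pure_tensor_bilinear] assms)

text \<open>A map that is linear in each of three variables stays linear in the first one after the other
  two are merged into a tensor: both sides of each linearity equation are linear in the tensor, so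
  it suffices to compare them on pure tensors.\<close>

lemma tensor_lift_parameter_hom:
  assumes U: "vectorspace K U" and V: "vectorspace K V"
    and P: "Module.module K P" and W: "Module.module K W"
    and bil: "\<And>p. p \<in> carrier P \<Longrightarrow> bilinear_map K U V W (h p)"
    and par: "\<And>u v. u \<in> carrier U \<Longrightarrow> v \<in> carrier V \<Longrightarrow> (\<lambda>p. h p u v) \<in> linear_maps K P W"
    and t: "t \<in> carrier (tensor K U V)"
  shows "(\<lambda>p. tensor_lift K W (h p) t) \<in> linear_maps K P W"
proof -
  interpret P: Module.module K P by fact
  note L = tensor_lift_hom[OF U V W bil] and Lp = tensor_lift_pure[OF U V W bil]
  show ?thesis
  proof (rule linear_mapsI)
    fix p assume p: "p \<in> carrier P"
    then show "tensor_lift K W (h p) t \<in> carrier W" using linear_mapsD(1)[OF L] t by blast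
    fix p' assume p': "p' \<in> carrier P"
    show "tensor_lift K W (h (p \<oplus>\<^bsub>P\<^esub> p')) t = tensor_lift K W (h p) t \<oplus>\<^bsub>W\<^esub> tensor_lift K W (h p') t"
      by (rule tensor_hom_ext[OF U V W L linear_maps_sum[OF W L L] _ t])
         (simp_all add: p p' Lp linear_mapsD[OF par])
  next
    fix a p assume a: "a \<in> carrier K" and p: "p \<in> carrier P"
    show "tensor_lift K W (h (a \<odot>\<^bsub>P\<^esub> p)) t = a \<odot>\<^bsub>W\<^esub> tensor_lift K W (h p) t"
      by (rule tensor_hom_ext[OF U V W L linear_maps_scaled[OF W a L] _ t])
         (simp_all add: a p Lp linear_mapsD[OF par])
  qed
qed

text \<open>Currying reduces a tensor product of three spaces to two applications of extensionality: for a
  fixed last factor, the pure tensor is linear in the first one.\<close>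

lemma tensor_hom_ext_left:
  assumes U: "vectorspace K U" and V: "vectorspace K V" and X: "vectorspace K X"
    and W: "Module.module K W"
    and h: "h \<in> linear_maps K (tensor K (tensor K U V) X) W"
    and g: "g \<in> linear_maps K (tensor K (tensor K U V) X) W"
    and eq: "\<And>u v x. u \<in> carrier U \<Longrightarrow> v \<in> carrier V \<Longrightarrow> x \<in> carrier X \<Longrightarrow>
      h (pure_tensor K (tensor K U V) X (pure_tensor K U V u v) x) =
      g (pure_tensor K (tensor K U V) X (pure_tensor K U V u v) x)"
    and t: "t \<in> carrier (tensor K (tensor K U V) X)"
  shows "h t = g t"
proof (rule tensor_hom_ext[OF tensor_vectorspace[OF U V] X W h g _ t])
  fix s x assume s: "s \<in> carrier (tensor K U V)" and x: "x \<in> carrier X"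
  note p = bilinear_mapD(2)[OF pure_tensor_bilinear[OF tensor_vectorspace[OF U V] X] x]
  show "h (pure_tensor K (tensor K U V) X s x) = g (pure_tensor K (tensor K U V) X s x)"
    by (rule tensor_hom_ext[OF U V W module_hom_comp[OF p h] module_hom_comp[OF p g] _ s])
       (rule eq[OF _ _ x])
qed

text \<open>The middle flip is treated from the inside out: four-fold linearity of
  \<open>(a \<otimes> c) \<otimes> (b \<otimes> d)\<close> is traded for bilinearity in \<open>(a, b)\<close> with the second pair merged into
  one tensor, and then for bilinearity in the two tensors.\<close>

context
  fixes K :: "('k, 'm) ring_scheme" and V :: "('k, 'v, 'a) module_scheme"
  assumes V: "vectorspace K V"
begin

private abbreviation "V2 \<equiv> tensor K V V"
private abbreviation "V4 \<equiv> tensor K V2 V2"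

private lemma V2: "vectorspace K V2" by (rule tensor_vectorspace[OF V V])
private lemma V4: "Module.module K V4" by (rule tensor_module[OF V2 V2])
private lemma V2m: "Module.module K V2" by (rule tensor_module[OF V V])
private lemma Vm: "Module.module K V" using V by (simp add: vectorspace_def)

private abbreviation "swapped a b c d \<equiv> pure_tensor K V2 V2 (pure_tensor K V V a c) (pure_tensor K V V b d)"

private lemma inner_bilinear:
  assumes "a \<in> carrier V" "b \<in> carrier V"
  shows "bilinear_map K V V V4 (\<lambda>c d. swapped a b c d)"
  by (rule bilinear_map_comp[OF pure_tensor_bilinear[OF V2 V2]])
     (rule bilinear_mapD(1)[OF pure_tensor_bilinear[OF V V]], fact)+

private lemma outer_bilinear:
  assumes "c \<in> carrier V" "d \<in> carrier V"
  shows "bilinear_map K V V V4 (\<lambda>a b. swapped a b c d)"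
  by (rule bilinear_map_comp[OF pure_tensor_bilinear[OF V2 V2]])
     (rule bilinear_mapD(2)[OF pure_tensor_bilinear[OF V V]], fact)+

private abbreviation "inner a b \<equiv> tensor_lift K V4 (\<lambda>c d. swapped a b c d)"

private lemma inner_lift_bilinear:
  assumes t: "t \<in> carrier V2"
  shows "bilinear_map K V V V4 (\<lambda>a b. inner a b t)"
proof (rule bilinear_mapI)
  fix a assume a: "a \<in> carrier V"
  show "(\<lambda>b. inner a b t) \<in> linear_maps K V V4"
    by (rule tensor_lift_parameter_hom[OF V V Vm V4 _ _ t])
       (use a in \<open>auto intro: inner_bilinear bilinear_mapD(1)[OF outer_bilinear]\<close>)
next
  fix b assume b: "b \<in> carrier V"
  show "(\<lambda>a. inner a b t) \<in> linear_maps K V V4"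
    by (rule tensor_lift_parameter_hom[OF V V Vm V4 _ _ t])
       (use b in \<open>auto intro: inner_bilinear bilinear_mapD(2)[OF outer_bilinear]\<close>)
qed

private lemma flip_bilinear:
  "bilinear_map K V2 V2 V4 (\<lambda>s t. tensor_lift K V4 (\<lambda>a b. inner a b t) s)"
proof (rule bilinear_mapI)
  fix s assume s: "s \<in> carrier V2"
  show "(\<lambda>t. tensor_lift K V4 (\<lambda>a b. inner a b t) s) \<in> linear_maps K V2 V4"
    by (rule tensor_lift_parameter_hom[OF V V V2m V4 _ _ s])
       (auto intro: inner_lift_bilinear tensor_lift_hom[OF V V V4 inner_bilinear])
next
  fix t assume t: "t \<in> carrier V2"
  show "tensor_lift K V4 (\<lambda>a b. inner a b t) \<in> linear_maps K V2 V4"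
    by (rule tensor_lift_hom[OF V V V4 inner_lift_bilinear[OF t]])
qed

lemma tensor_flip_mid_hom: "tensor_flip_mid K V \<in> linear_maps K V4 V4"
  unfolding tensor_flip_mid_def Let_def by (rule tensor_lift_hom[OF V2 V2 V4 flip_bilinear])

lemma tensor_flip_mid_pure:
  assumes a: "a \<in> carrier V" and b: "b \<in> carrier V" and c: "c \<in> carrier V" and d: "d \<in> carrier V"
  shows "tensor_flip_mid K V (pure_tensor K V2 V2 (pure_tensor K V V a b) (pure_tensor K V V c d)) =
    pure_tensor K V2 V2 (pure_tensor K V V a c) (pure_tensor K V V b d)"
proof -
  note p = bilinear_map_closed[OF pure_tensor_bilinear[OF V V]]
  show ?thesis unfolding tensor_flip_mid_def Let_def
    by (subst tensor_lift_pure[OF V2 V2 V4 flip_bilinear p[OF a b] p[OF c d]],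
        subst tensor_lift_pure[OF V V V4 inner_lift_bilinear[OF p[OF c d]] a b],
        rule tensor_lift_pure[OF V V V4 inner_bilinear[OF a b] c d])
qed

end


section \<open>The coalgebra of a Lie algebra\<close>

context lie_algebra
begin

abbreviation "N \<equiv> lie_ext K L"
abbreviation "N2 \<equiv> tensor K N N"
abbreviation "N4 \<equiv> tensor K N2 N2"
abbreviation pure (infixl "\<otimes>N" 70) where "pure \<equiv> pure_tensor K N N"
abbreviation pure2 (infixl "\<otimes>N2" 65) where "pure2 \<equiv> pure_tensor K N2 N2"
abbreviation "\<Delta> \<equiv> lie_comult K L"
abbreviation "q \<equiv> lie_q K L bracket"

abbreviation "unit_N \<equiv> (\<one>\<^bsub>K\<^esub>, \<zero>\<^bsub>L\<^esub>)"
abbreviation "prim x \<equiv> (\<zero>\<^bsub>K\<^esub>, x)"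

lemma self_module_vectorspace: "vectorspace K (self_module K)"
proof -
  have "Module.module K (self_module K)"
    apply (rule module_criteria)
    apply (rule R.cring_axioms)
    unfolding self_module_def
    by (auto simp: R.a_ac R.m_assoc R.l_distr R.r_distr intro: R.add.r_inv_ex)
  then show ?thesis by (simp add: vectorspace_def field_axioms)
qed

lemma N_vectorspace: "vectorspace K N"
  unfolding lie_ext_def
  by (rule direct_sum_is_vs[OF self_module_vectorspace]) (rule vectorspace_axioms)

lemma N_module: "Module.module K N"
  using N_vectorspace by (simp add: vectorspace_def)

lemma N2_vectorspace: "vectorspace K N2"
  by (rule tensor_vectorspace[OF N_vectorspace N_vectorspace])

lemma N2_module: "Module.module K N2"
  by (rule tensor_module[OF N_vectorspace N_vectorspace])

lemma N_simps [simp]: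
  "carrier N = carrier K \<times> carrier L"
  "(a, x) \<oplus>\<^bsub>N\<^esub> (b, y) = (a \<oplus>\<^bsub>K\<^esub> b, x \<oplus>\<^bsub>L\<^esub> y)"
  "c \<odot>\<^bsub>N\<^esub> (a, x) = (c \<otimes>\<^bsub>K\<^esub> a, c \<odot>\<^bsub>L\<^esub> x)"
  "\<zero>\<^bsub>N\<^esub> = (\<zero>\<^bsub>K\<^esub>, \<zero>\<^bsub>L\<^esub>)"
  by (simp_all add: lie_ext_def direct_sum_def self_module_def)

lemma bilinear_L:
  assumes f: "bilinear_map K L L L f" and x: "x \<in> carrier L" and y: "y \<in> carrier L"
  shows "f x y \<in> carrier L"
    and "z \<in> carrier L \<Longrightarrow> f (x \<oplus>\<^bsub>L\<^esub> y) z = f x z \<oplus>\<^bsub>L\<^esub> f y z"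
    and "z \<in> carrier L \<Longrightarrow> f z (x \<oplus>\<^bsub>L\<^esub> y) = f z x \<oplus>\<^bsub>L\<^esub> f z y"
    and "a \<in> carrier K \<Longrightarrow> f (a \<odot>\<^bsub>L\<^esub> x) y = a \<odot>\<^bsub>L\<^esub> f x y"
    and "a \<in> carrier K \<Longrightarrow> f x (a \<odot>\<^bsub>L\<^esub> y) = a \<odot>\<^bsub>L\<^esub> f x y"
  using bilinear_map_closed[OF f x y] x y
    linear_mapsD[OF bilinear_mapD(1)[OF f]] linear_mapsD[OF bilinear_mapD(2)[OF f]]
  by simp_all

lemmas bilinear_L_zero = bilinear_map_zero[OF module_axioms module_axioms module_axioms]

lemma bilinear_L_minus:
  assumes f: "bilinear_map K L L L f" and x: "x \<in> carrier L" and y: "y \<in> carrier L"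
  shows "f (\<ominus>\<^bsub>L\<^esub> x) y = \<ominus>\<^bsub>L\<^esub> f x y"
proof -
  have "f (\<ominus>\<^bsub>L\<^esub> x) y \<oplus>\<^bsub>L\<^esub> f x y = f (\<ominus>\<^bsub>L\<^esub> x \<oplus>\<^bsub>L\<^esub> x) y"
    using x y by (simp add: bilinear_L(2)[OF f])
  also have "\<dots> = \<zero>\<^bsub>L\<^esub>" using x y by (simp add: M.l_neg bilinear_L_zero[OF f])
  finally show ?thesis using x y by (simp add: M.minus_equality bilinear_L(1)[OF f])
qed

text \<open>Polarization: expand \<open>[y + x, y + x] = 0\<close>.\<close>

lemma bracket_antisym:
  assumes x: "x \<in> carrier L" and y: "y \<in> carrier L"
  shows "bracket y x = \<ominus>\<^bsub>L\<^esub> bracket x y"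
proof -
  note B = bilinear_L[OF bracket_bilinear]
  have "\<zero>\<^bsub>L\<^esub> = bracket (y \<oplus>\<^bsub>L\<^esub> x) (y \<oplus>\<^bsub>L\<^esub> x)" using x y by (simp only: bracket_alternating M.a_closed)
  also have "\<dots> = (bracket y y \<oplus>\<^bsub>L\<^esub> bracket x y) \<oplus>\<^bsub>L\<^esub> (bracket y x \<oplus>\<^bsub>L\<^esub> bracket x x)"
    using x y by (simp add: B)
  also have "\<dots> = bracket y x \<oplus>\<^bsub>L\<^esub> bracket x y"
    using x y by (simp add: B bracket_alternating M.a_ac)
  finally show ?thesis using x y by (metis B(1) M.minus_equality)
qed

lemma q_bilinear:
  "bilinear_map K N N N (\<lambda>(a, x) (b, y). (a \<otimes>\<^bsub>K\<^esub> b, b \<odot>\<^bsub>L\<^esub> x \<oplus>\<^bsub>L\<^esub> bracket x y))"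
  by (intro bilinear_mapI linear_mapsI; clarsimp)
     (simp_all add: bilinear_L[OF bracket_bilinear] M.a_ac R.l_distr R.r_distr
        R.m_ac smult_l_distr smult_r_distr flip: smult_assoc1)

lemma q_hom: "q \<in> linear_maps K N2 N"
  unfolding lie_q_def by (rule tensor_lift_hom[OF N_vectorspace N_vectorspace N_module q_bilinear])

lemma q_pure:
  assumes "a \<in> carrier K" "x \<in> carrier L" "b \<in> carrier K" "y \<in> carrier L"
  shows "q ((a, x) \<otimes>N (b, y)) = (a \<otimes>\<^bsub>K\<^esub> b, b \<odot>\<^bsub>L\<^esub> x \<oplus>\<^bsub>L\<^esub> bracket x y)"
  unfolding lie_q_def
  by (subst tensor_lift_pure[OF N_vectorspace N_vectorspace N_module q_bilinear]) (use assms in auto)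

lemma hat_bilinear:
  assumes "bilinear_map K L L L \<psi>"
  shows "bilinear_map K N N N (\<lambda>(a, x) (b, y). (\<zero>\<^bsub>K\<^esub>, \<psi> x y))"
  by (intro bilinear_mapI linear_mapsI; clarsimp) (simp_all add: bilinear_L[OF assms])

lemma hat_hom:
  assumes "bilinear_map K L L L \<psi>"
  shows "lie_cocycle_hat K L \<psi> \<in> linear_maps K N2 N"
  unfolding lie_cocycle_hat_def
  by (rule tensor_lift_hom[OF N_vectorspace N_vectorspace N_module hat_bilinear[OF assms]])

lemma hat_pure:
  assumes "bilinear_map K L L L \<psi>"
    and "a \<in> carrier K" "x \<in> carrier L" "b \<in> carrier K" "y \<in> carrier L"
  shows "lie_cocycle_hat K L \<psi> ((a, x) \<otimes>N (b, y)) = prim (\<psi> x y)"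
  unfolding lie_cocycle_hat_def
  by (subst tensor_lift_pure[OF N_vectorspace N_vectorspace N_module hat_bilinear[OF assms(1)]])
     (use assms in auto)

lemma pure_closed: "u \<in> carrier N \<Longrightarrow> v \<in> carrier N \<Longrightarrow> u \<otimes>N v \<in> carrier N2"
  by (rule bilinear_map_closed[OF pure_tensor_bilinear[OF N_vectorspace N_vectorspace]])

lemma pure_zero:
  assumes "u \<in> carrier N"
  shows "prim \<zero>\<^bsub>L\<^esub> \<otimes>N u = \<zero>\<^bsub>N2\<^esub>" "u \<otimes>N prim \<zero>\<^bsub>L\<^esub> = \<zero>\<^bsub>N2\<^esub>"
  using bilinear_map_zero[OF N_module N_module N2_module
      pure_tensor_bilinear[OF N_vectorspace N_vectorspace]] assms by (simp_all del: N_simps(1-3))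

lemma comult_hom: "\<Delta> \<in> linear_maps K N N2"
proof -
  interpret N2: Module.module K N2 by (rule N2_module)
  have e: "unit_N \<in> carrier N" by simp
  note cl = pure_closed[unfolded N_simps(1)]
  note p = pure_tensor_bilinear[OF N_vectorspace N_vectorspace]
  have prim: "(\<lambda>x. prim x) \<in> linear_maps K L N" by (rule linear_mapsI) auto
  note r = module_hom_comp[OF prim bilinear_mapD(1)[OF p e]]
  note l = module_hom_comp[OF prim bilinear_mapD(2)[OF p e]]
  show ?thesis
    by (rule linear_mapsI; clarsimp simp: lie_comult_def Let_def)
       (simp_all add: linear_mapsD[OF l] linear_mapsD[OF r] cl N2.smult_l_distr N2.smult_assoc1 N2.smult_r_distr N2.a_ac)
qed

text \<open>Stated for an arbitrary linear map \<open>h\<close>, so that expanding a comultiplication inside any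
  composite of linear maps is a single rewriting step.\<close>

lemma hom_comult:
  assumes h: "h \<in> linear_maps K N2 W" and "c \<in> carrier K" "z \<in> carrier L"
  shows "h (\<Delta> (c, z)) = c \<odot>\<^bsub>W\<^esub> h (unit_N \<otimes>N unit_N) \<oplus>\<^bsub>W\<^esub>
    (h (prim z \<otimes>N unit_N) \<oplus>\<^bsub>W\<^esub> h (unit_N \<otimes>N prim z))"
proof -
  interpret N2: Module.module K N2 by (rule N2_module)
  show ?thesis using assms by (simp add: lie_comult_def Let_def linear_mapsD[OF h] pure_closed)
qed

text \<open>The common shape of the three terms of \<open>d21\<close> that involve \<open>\<tau>\<^sub>2(1 \<otimes> 1 \<otimes> \<Delta>)\<close>; in \<open>d22\<close> it
  expands the second comultiplication.\<close>

lemma hom_flip_comult: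
  assumes h: "h \<in> linear_maps K N4 W" and "X \<in> carrier N" "Y \<in> carrier N"
    and "c \<in> carrier K" "z \<in> carrier L"
  shows "h (tensor_flip_mid K N (X \<otimes>N Y \<otimes>N2 \<Delta> (c, z))) =
    c \<odot>\<^bsub>W\<^esub> h (X \<otimes>N unit_N \<otimes>N2 (Y \<otimes>N unit_N)) \<oplus>\<^bsub>W\<^esub>
    (h (X \<otimes>N prim z \<otimes>N2 (Y \<otimes>N unit_N)) \<oplus>\<^bsub>W\<^esub> h (X \<otimes>N unit_N \<otimes>N2 (Y \<otimes>N prim z)))"
proof -
  note p = bilinear_mapD(1)[OF pure_tensor_bilinear[OF N2_vectorspace N2_vectorspace]
      pure_closed[OF assms(2,3)]]
  note H = module_hom_comp[OF module_hom_comp[OF p tensor_flip_mid_hom[OF N_vectorspace]] h]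
  show ?thesis using assms by (simp add: hom_comult[OF H] tensor_flip_mid_pure[OF N_vectorspace])
qed

end

section \<open>The shelf cocycle of a Lie algebra cocycle\<close>

locale lie_cocycle = lie_algebra +
  fixes \<psi>
  assumes cocycle: "lie_2_cocycle K L bracket \<psi>"
begin

abbreviation "\<eta> \<equiv> lie_cocycle_hat K L \<psi>"

lemma \<psi>_bilinear: "bilinear_map K L L L \<psi>"
  using cocycle by (simp add: lie_2_cocycle_def)

lemmas \<psi>_simps = bilinear_L[OF \<psi>_bilinear] bilinear_L_zero[OF \<psi>_bilinear]
lemmas bracket_simps = bilinear_L[OF bracket_bilinear] bilinear_L_zero[OF bracket_bilinear]
lemmas \<eta>_hom = hat_hom[OF \<psi>_bilinear]
lemmas \<eta>_pure = hat_pure[OF \<psi>_bilinear]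

lemma \<psi>_antisym: "x \<in> carrier L \<Longrightarrow> y \<in> carrier L \<Longrightarrow> \<psi> y x = \<ominus>\<^bsub>L\<^esub> \<psi> x y"
  using cocycle unfolding lie_2_cocycle_def by blast

text \<open>The cyclic cocycle identity with its arguments put in the order \<open>x, y, z\<close>, which is the order
  produced by \<open>d21\<close>: four of its six terms change sign and move to the other side.\<close>

lemma cocycle_eq:
  assumes "x \<in> carrier L" "y \<in> carrier L" "z \<in> carrier L"
  shows "bracket (\<psi> x y) z \<oplus>\<^bsub>L\<^esub> \<psi> (bracket x y) z =
    \<psi> (bracket x z) y \<oplus>\<^bsub>L\<^esub> \<psi> x (bracket y z) \<oplus>\<^bsub>L\<^esub> bracket (\<psi> x z) y \<oplus>\<^bsub>L\<^esub> bracket x (\<psi> y z)"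
proof -
  let ?r = "\<psi> (bracket x z) y \<oplus>\<^bsub>L\<^esub> \<psi> x (bracket y z) \<oplus>\<^bsub>L\<^esub> bracket (\<psi> x z) y \<oplus>\<^bsub>L\<^esub> bracket x (\<psi> y z)"
  have "bracket (\<psi> x y) z \<oplus>\<^bsub>L\<^esub> bracket (\<psi> y z) x \<oplus>\<^bsub>L\<^esub> bracket (\<psi> z x) y \<oplus>\<^bsub>L\<^esub>
      \<psi> (bracket x y) z \<oplus>\<^bsub>L\<^esub> \<psi> (bracket y z) x \<oplus>\<^bsub>L\<^esub> \<psi> (bracket z x) y = \<zero>\<^bsub>L\<^esub>"
    using cocycle assms unfolding lie_2_cocycle_def by blast
  moreover have "bracket (\<psi> y z) x = \<ominus>\<^bsub>L\<^esub> bracket x (\<psi> y z)"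
    "bracket (\<psi> z x) y = \<ominus>\<^bsub>L\<^esub> bracket (\<psi> x z) y"
    "\<psi> (bracket y z) x = \<ominus>\<^bsub>L\<^esub> \<psi> x (bracket y z)"
    "\<psi> (bracket z x) y = \<ominus>\<^bsub>L\<^esub> \<psi> (bracket x z) y"
    using assms
    by (simp_all add: bracket_antisym[of x "\<psi> y z"] \<psi>_antisym[of x z] \<psi>_antisym[of x "bracket y z"]
        bracket_antisym[of x z] bilinear_L_minus[OF \<psi>_bilinear] bilinear_L_minus[OF bracket_bilinear] \<psi>_simps bracket_simps)
  ultimately have "(bracket (\<psi> x y) z \<oplus>\<^bsub>L\<^esub> \<psi> (bracket x y) z) \<oplus>\<^bsub>L\<^esub> \<ominus>\<^bsub>L\<^esub> ?r = \<zero>\<^bsub>L\<^esub>"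
    using assms by (simp add: \<psi>_simps bracket_simps M.minus_add M.a_ac)
  from M.minus_equality[OF this] show ?thesis
    using assms by (simp add: \<psi>_simps bracket_simps)
qed

lemmas tensor_map_N_hom = tensor_map_hom[OF N2_vectorspace N2_vectorspace N_vectorspace N_vectorspace]
lemmas tensor_map_N_pure = tensor_map_pure[OF N2_vectorspace N2_vectorspace N_vectorspace N_vectorspace]
lemmas tensor_map_N3_hom = tensor_map_hom[OF N2_vectorspace N_vectorspace N_vectorspace N_vectorspace _ linear_maps_id]
lemmas tensor_map_N3_pure = tensor_map_pure[OF N2_vectorspace N_vectorspace N_vectorspace N_vectorspace _ linear_maps_id]

lemma d21_vanishes:
  assumes t: "t \<in> carrier (tensor K N2 N)"
  shows "d21 K N \<Delta> q \<eta> t = \<zero>\<^bsub>N\<^esub>"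
proof -
  interpret N: Module.module K N by (rule N_module)
  let ?s = "\<lambda>t. tensor_flip_mid K N (tensor_map K N2 N2 (\<lambda>x. x) \<Delta> t)"
  let ?l = "\<lambda>t. q (tensor_map K N N \<eta> (\<lambda>x. x) t) \<oplus>\<^bsub>N\<^esub> \<eta> (tensor_map K N N q (\<lambda>x. x) t)"
  let ?r = "\<lambda>t. \<eta> (tensor_map K N N q q (?s t)) \<oplus>\<^bsub>N\<^esub> q (tensor_map K N N \<eta> q (?s t))
    \<oplus>\<^bsub>N\<^esub> q (tensor_map K N N q \<eta> (?s t))"
  note idD = tensor_map_hom[OF N2_vectorspace N_vectorspace N2_vectorspace N2_vectorspace linear_maps_id comult_hom]
  note s = module_hom_comp[OF idD tensor_flip_mid_hom[OF N_vectorspace]]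
  note qq = module_hom_comp[OF tensor_map_N_hom[OF q_hom q_hom] \<eta>_hom]
  note \<eta>q = module_hom_comp[OF tensor_map_N_hom[OF \<eta>_hom q_hom] q_hom]
  note q\<eta> = module_hom_comp[OF tensor_map_N_hom[OF q_hom \<eta>_hom] q_hom]
  have l: "?l \<in> linear_maps K (tensor K N2 N) N"
    by (intro linear_maps_sum N_module module_hom_comp[OF tensor_map_N3_hom] q_hom \<eta>_hom)
  have r: "?r \<in> linear_maps K (tensor K N2 N) N"
    by (intro linear_maps_sum N_module module_hom_comp[OF s] qq \<eta>q q\<eta>)
  have "?l t = ?r t"
  proof (rule tensor_hom_ext_left[OF N_vectorspace N_vectorspace N_vectorspace N_module l r _ t])
    fix X Y Z assume XYZ: "X \<in> carrier N" "Y \<in> carrier N" "Z \<in> carrier N"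
    obtain a x b y c z where [simp]: "X = (a, x)" "Y = (b, y)" "Z = (c, z)" by (metis surj_pair)
    have [simp]: "a \<in> carrier K" "x \<in> carrier L" "b \<in> carrier K" "y \<in> carrier L"
      "c \<in> carrier K" "z \<in> carrier L" using XYZ by auto
    \<comment> \<open>\<open>?w\<close> collects the terms with the scalars \<open>c\<close> and \<open>b\<close>, which occur on both sides.\<close>
    let ?T = "pure_tensor K N2 N (X \<otimes>N Y) Z" and ?w = "c \<odot>\<^bsub>L\<^esub> \<psi> x y \<oplus>\<^bsub>L\<^esub> b \<odot>\<^bsub>L\<^esub> \<psi> x z"
    have "?l ?T = prim (?w \<oplus>\<^bsub>L\<^esub> (bracket (\<psi> x y) z \<oplus>\<^bsub>L\<^esub> \<psi> (bracket x y) z))"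
      by (simp add: tensor_map_N3_pure q_hom \<eta>_hom pure_closed q_pure \<eta>_pure \<psi>_simps bracket_simps
          M.a_ac)
    also have "\<dots> = prim (?w \<oplus>\<^bsub>L\<^esub> (\<psi> (bracket x z) y \<oplus>\<^bsub>L\<^esub> \<psi> x (bracket y z) \<oplus>\<^bsub>L\<^esub>
        bracket (\<psi> x z) y \<oplus>\<^bsub>L\<^esub> bracket x (\<psi> y z)))"
      by (simp add: cocycle_eq)
    also have "\<dots> = ?r ?T"
      by (simp add: pure_closed
          tensor_map_pure[OF N2_vectorspace N_vectorspace N2_vectorspace N2_vectorspace linear_maps_id comult_hom]
          hom_flip_comult[OF qq] hom_flip_comult[OF \<eta>q] hom_flip_comult[OF q\<eta>] tensor_map_N_pure
          q_hom \<eta>_hom q_pure \<eta>_pure \<psi>_simps bracket_simps M.a_ac)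
    finally show "?l ?T = ?r ?T" .
  qed
  then show ?thesis using linear_mapsD(1)[OF l t] linear_mapsD(1)[OF r t]
    by (simp add: d21_def Let_def N.r_neg a_minus_def del: N_simps)
qed

lemma d22_vanishes:
  assumes t: "t \<in> carrier N2"
  shows "d22 K N \<Delta> q \<eta> t = \<zero>\<^bsub>N2\<^esub>"
proof -
  interpret N2: Module.module K N2 by (rule N2_module)
  let ?s = "\<lambda>t. tensor_flip_mid K N (tensor_map K N2 N2 \<Delta> \<Delta> t)"
  let ?l = "\<lambda>t. \<Delta> (\<eta> t)"
  let ?r = "\<lambda>t. tensor_map K N N \<eta> q (?s t) \<oplus>\<^bsub>N2\<^esub> tensor_map K N N q \<eta> (?s t)"
  note DD = tensor_map_hom[OF N_vectorspace N_vectorspace N2_vectorspace N2_vectorspace comult_hom comult_hom]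
  note s = module_hom_comp[OF DD tensor_flip_mid_hom[OF N_vectorspace]]
  note \<eta>q = tensor_map_N_hom[OF \<eta>_hom q_hom]
  note q\<eta> = tensor_map_N_hom[OF q_hom \<eta>_hom]
  have l: "?l \<in> linear_maps K N2 N2" by (rule module_hom_comp[OF \<eta>_hom comult_hom])
  have r: "?r \<in> linear_maps K N2 N2"
    by (intro linear_maps_sum N2_module module_hom_comp[OF s] \<eta>q q\<eta>)
  have "?l t = ?r t"
  proof (rule tensor_hom_ext[OF N_vectorspace N_vectorspace N2_module l r _ t])
    fix X Y assume XY: "X \<in> carrier N" "Y \<in> carrier N"
    obtain a x b y where [simp]: "X = (a, x)" "Y = (b, y)" by (metis surj_pair)
    have [simp]: "a \<in> carrier K" "x \<in> carrier L" "b \<in> carrier K" "y \<in> carrier L" using XY by auto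
    \<comment> \<open>Freezing \<open>\<Delta>Y\<close> leaves a linear map applied to \<open>\<Delta>X\<close>, so the two comultiplications can be
      expanded one after the other.\<close>
    note p = bilinear_mapD(2)[OF pure_tensor_bilinear[OF N2_vectorspace N2_vectorspace]
        linear_mapsD(1)[OF comult_hom XY(2)]]
    note H = module_hom_comp[OF module_hom_comp[OF p tensor_flip_mid_hom[OF N_vectorspace]]]
    have st: "?s (X \<otimes>N Y) = tensor_flip_mid K N (\<Delta> (a, x) \<otimes>N2 \<Delta> (b, y))"
      by (simp add: comult_hom tensor_map_pure[OF N_vectorspace N_vectorspace N2_vectorspace N2_vectorspace])
    have 1: "tensor_map K N N \<eta> q (?s (X \<otimes>N Y)) = prim (\<psi> x y) \<otimes>N unit_N"
      unfolding st using hom_comult[OF H[OF \<eta>q], of a x]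
      by (simp add: pure_closed hom_flip_comult[OF \<eta>q] tensor_map_N_pure
          q_hom \<eta>_hom q_pure \<eta>_pure \<psi>_simps bracket_simps pure_zero)
    have 2: "tensor_map K N N q \<eta> (?s (X \<otimes>N Y)) = unit_N \<otimes>N prim (\<psi> x y)"
      unfolding st using hom_comult[OF H[OF q\<eta>], of a x]
      by (simp add: pure_closed hom_flip_comult[OF q\<eta>] tensor_map_N_pure
          q_hom \<eta>_hom q_pure \<eta>_pure \<psi>_simps bracket_simps pure_zero)
    show "?l (X \<otimes>N Y) = ?r (X \<otimes>N Y)"
      unfolding 1 2 by (simp add: \<eta>_pure \<psi>_simps hom_comult[OF linear_maps_id] pure_closed)
  qed
  then show ?thesis using linear_mapsD(1)[OF l t] linear_mapsD(1)[OF r t]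
    by (simp add: d22_def Let_def N2.r_neg a_minus_def)
qed

end

theorem theorem7p6:
  fixes K :: "('k, 'm) ring_scheme" and G :: "('k, 'g, 'n) module_scheme"
    and bracket \<psi> :: "'g \<Rightarrow> 'g \<Rightarrow> 'g"
  assumes "lie_algebra K G bracket"
    and "characteristic K \<noteq> 2"
    and "lie_2_cocycle K G bracket \<psi>"
  shows "shelf_2_cocycle K (lie_ext K G) (lie_comult K G) (lie_q K G bracket)
           (lie_cocycle_hat K G \<psi>)"
proof -
  interpret lie_cocycle K G bracket \<psi>
    by (intro lie_cocycle.intro lie_cocycle_axioms.intro assms(1,3))
  show ?thesis
    unfolding shelf_2_cocycle_def using \<eta>_hom d21_vanishes d22_vanishes by blast
qed

end
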